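(* Let $p>3$ be an odd prime, let $j\in\mathbb{N}$, and set $G=S(p,j)$, the finite group of order $p^{p^j+2j-1}$ defined in the context, with elements $a_1,b\in G$ as there. Then $$G_{p^j}(ba_1,a_1^{p^j})=\emptyset\qquad\text{and}\qquad G_{p^j}(ba_1,a_1^{2p^j})\neq\emptyset .$$ In particular, $S(p,j)$ is not an $FSZ_{p^j}$-group.
   Context: $\mathbb{N}=\{1,2,\dots\}$ denotes the positive integers. The group $S(p,j)$. For an odd prime $p$ and $j\in\mathbb{N}$, let $P_{p,j}=\mathbb{Z}_{p^{j+1}}\times\mathbb{Z}_p^{\,p^j-2}$ be the abelian $p$-group, written multiplicatively, with generators $a_1,\dots,a_{p^j-1}$ of the cyclic factors, where $a_1$ has order $p^{j+1}$ and $a_2,\dots,a_{p^j-1}$ have order $p$. Let $b=b_{p,j}$ be the endomorphism of $P_{p,j}$ given by $$a_1\mapsto a_1a_2^{-1},\qquad a_k\mapsto a_ka_{k+1}\ \ (1<k<p^j-1),\qquad a_{p^j-1}\mapsto a_{p^j-1}a_1^{-p^j}.$$ The endomorphism $b$ is an automorphism of $P_{p,j}$ of order $p^j$. Define $S(p,j)=P_{p,j}\rtimes\langle b_{p,j}\rangle$, the semidirect product with respect to the natural action of $\langle b\rangle$ on $P_{p,j}$, so that $bqb^{-1}=b(q)$ for $q\in P_{p,j}$; $P_{p,j}$ and $\langle b\rangle$ are identified with subgroups of $S(p,j)$ in the usual way. The order of $S(p,j)$ is $p^{p^j+2j-1}$. The sets $G_n(u,g)$. For a group $G$, $n\in\mathbb{N}$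 and $g,u\in G$, define $$G_n(u,g)=\{a\in G : a^n=(au^{-1})^n=g\}.$$ The $FSZ_n$ property. For $n\in\mathbb{N}$, a finite group $G$ is called an $FSZ_n$-group if for all commuting pairs of elements $u,g\in G$ and all integers $m$ coprime to $|G|$ one has $|G_n(u,g)|=|G_n(u,g^m)|$. *)

theory Defs
  imports "HOL-Algebra.Product_Groups" "HOL-Algebra.FiniteProduct" "HOL-Algebra.Bij" "HOL-Computational_Algebra.Primes"
begin

section \<open>Semidirect products\<close>

text \<open>\<open>\<phi> h\<close> is the action of \<open>h \<in> H\<close> on \<open>N\<close>, so that
  \<open>(\<one>, h) (q, \<one>) (\<one>, h)\<^sup>-\<^sup>1 = (\<phi> h q, \<one>)\<close>.\<close>

definition semidirect_product ::
  "('a, 'm) monoid_scheme \<Rightarrow> ('b, 'n) monoid_scheme \<Rightarrow> ('b \<Rightarrow> 'a \<Rightarrow> 'a) \<Rightarrow> ('a \<times> 'b) monoid"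
  where
  "semidirect_product N H \<phi> =
     \<lparr>carrier = carrier N \<times> carrier H,
      monoid.mult = (\<lambda>(q, h) (q', h'). (q \<otimes>\<^bsub>N\<^esub> \<phi> h q', h \<otimes>\<^bsub>H\<^esub> h')),
      one = (\<one>\<^bsub>N\<^esub>, \<one>\<^bsub>H\<^esub>)\<rparr>"

lemma group_semidirect_product:
  assumes N: "group N" and H: "group H"
    and hom: "\<And>h. h \<in> carrier H \<Longrightarrow> \<phi> h \<in> hom N N"
    and act1: "\<And>q. q \<in> carrier N \<Longrightarrow> \<phi> \<one>\<^bsub>H\<^esub> q = q"
    and actm: "\<And>h h' q. \<lbrakk>h \<in> carrier H; h' \<in> carrier H; q \<in> carrier N\<rbrakk>
                 \<Longrightarrow> \<phi> (h \<otimes>\<^bsub>H\<^esub> h') q = \<phi> h (\<phi> h' q)"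
  shows "group (semidirect_product N H \<phi>)"
proof -
  interpret N: group N by (rule N)
  interpret H: group H by (rule H)
  have cl: "\<phi> h q \<in> carrier N" if "h \<in> carrier H" "q \<in> carrier N" for h q
    using hom_in_carrier[OF hom] that by blast
  have mu: "\<phi> h (q \<otimes>\<^bsub>N\<^esub> q') = \<phi> h q \<otimes>\<^bsub>N\<^esub> \<phi> h q'"
    if "h \<in> carrier H" "q \<in> carrier N" "q' \<in> carrier N" for h q q'
    using hom_mult[OF hom] that by blast
  have un: "\<phi> h \<one>\<^bsub>N\<^esub> = \<one>\<^bsub>N\<^esub>" if "h \<in> carrier H" for h
    using hom_one[OF hom[OF that] N N] .
  show ?thesis
  proof (rule groupI, goal_cases)
    case (5 x)
    then obtain q h where x: "x = (q, h)" "q \<in> carrier N" "h \<in> carrier H"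
      by (auto simp: semidirect_product_def)
    let ?y = "(\<phi> (inv\<^bsub>H\<^esub> h) (inv\<^bsub>N\<^esub> q), inv\<^bsub>H\<^esub> h)"
    have "\<phi> (inv\<^bsub>H\<^esub> h) (inv\<^bsub>N\<^esub> q) \<otimes>\<^bsub>N\<^esub> \<phi> (inv\<^bsub>H\<^esub> h) q = \<one>\<^bsub>N\<^esub>"
      using x by (simp flip: mu add: un)
    then show ?case
      using x cl by (intro bexI[of _ ?y]) (auto simp: semidirect_product_def)
  qed (auto simp: semidirect_product_def cl mu act1 actm N.m_assoc H.m_assoc)
qed


section \<open>The sets $G_n(u,g)$ and the $FSZ_n$ property\<close>

definition G_set :: "('a, 'm) monoid_scheme \<Rightarrow> nat \<Rightarrow> 'a \<Rightarrow> 'a \<Rightarrow> 'a set"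
  where
  "G_set G n u g =
     {a \<in> carrier G. a [^]\<^bsub>G\<^esub> n = g \<and> (a \<otimes>\<^bsub>G\<^esub> inv\<^bsub>G\<^esub> u) [^]\<^bsub>G\<^esub> n = g}"

text \<open>The property is only meant for finite groups \<open>G\<close>. These two requirements are not conjuncts
  of the definition, so that its negation does not hold for the wrong reason; for the groups
  \<open>S(p,j)\<close> they are the lemmas \<open>group_S_group\<close> and \<open>finite_S_group\<close> below.\<close>

definition FSZ :: "nat \<Rightarrow> ('a, 'm) monoid_scheme \<Rightarrow> bool"
  where
  "FSZ n G \<longleftrightarrow>
     (\<forall>u \<in> carrier G. \<forall>g \<in> carrier G. \<forall>m :: int.
        u \<otimes>\<^bsub>G\<^esub> g = g \<otimes>\<^bsub>G\<^esub> u \<and> coprime m (int (order G)) \<longrightarrow>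
        card (G_set G n u g) = card (G_set G n u (g [^]\<^bsub>G\<^esub> m)))"


section \<open>The abelian group $P_{p,j}$ and its automorphism $b_{p,j}$\<close>

definition P_index :: "nat \<Rightarrow> nat \<Rightarrow> nat set"
  where "P_index p j = {1 .. p ^ j - 1}"

definition P_ord :: "nat \<Rightarrow> nat \<Rightarrow> nat \<Rightarrow> nat"
  where "P_ord p j k = (if k = 1 then p ^ (j + 1) else p)"

text \<open>The factors are additive groups of residues, but the group operation of \<open>P_group p j\<close>
  is used in multiplicative notation.\<close>

definition P_group :: "nat \<Rightarrow> nat \<Rightarrow> (nat \<Rightarrow> int) monoid"
  where "P_group p j = product_group (P_index p j) (\<lambda>k. integer_mod_group (P_ord p j k))"

definition P_gen :: "nat \<Rightarrow> nat \<Rightarrow> nat \<Rightarrow> (nat \<Rightarrow> int)"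
  where "P_gen p j k = (\<lambda>i \<in> P_index p j. if i = k then 1 else 0)"

definition b_image :: "nat \<Rightarrow> nat \<Rightarrow> nat \<Rightarrow> (nat \<Rightarrow> int)"
  where
  "b_image p j k =
     (if k = 1 then P_gen p j 1 \<otimes>\<^bsub>P_group p j\<^esub> inv\<^bsub>P_group p j\<^esub> P_gen p j 2
      else if k < p ^ j - 1 then P_gen p j k \<otimes>\<^bsub>P_group p j\<^esub> P_gen p j (k + 1)
      else P_gen p j (p ^ j - 1) \<otimes>\<^bsub>P_group p j\<^esub>
             (P_gen p j 1 [^]\<^bsub>P_group p j\<^esub> (- int (p ^ j))))"

text \<open>An element \<open>q\<close> is the product of the powers \<open>a\<^sub>k\<^bsup>q k\<^esup>\<close>, so the endomorphism with prescribed
  images of the \<open>a\<^sub>k\<close> is the following one (see \<open>b_map_hom\<close> and \<open>b_map_gen\<close>). It is made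
  extensional because the elements of \<^const>\<open>AutoGroup\<close> are.\<close>

definition b_map :: "nat \<Rightarrow> nat \<Rightarrow> (nat \<Rightarrow> int) \<Rightarrow> (nat \<Rightarrow> int)"
  where
  "b_map p j = (\<lambda>q \<in> carrier (P_group p j).
     finprod (P_group p j) (\<lambda>k. b_image p j k [^]\<^bsub>P_group p j\<^esub> q k) (P_index p j))"


section \<open>The group $S(p,j)$\<close>

definition b_group :: "nat \<Rightarrow> nat \<Rightarrow> ((nat \<Rightarrow> int) \<Rightarrow> (nat \<Rightarrow> int)) monoid"
  where "b_group p j = subgroup_generated (AutoGroup (P_group p j)) {b_map p j}"

definition S_group ::
  "nat \<Rightarrow> nat \<Rightarrow> ((nat \<Rightarrow> int) \<times> ((nat \<Rightarrow> int) \<Rightarrow> (nat \<Rightarrow> int))) monoid"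
  where "S_group p j = semidirect_product (P_group p j) (b_group p j) (\<lambda>f q. f q)"

definition S_a :: "nat \<Rightarrow> nat \<Rightarrow> nat \<Rightarrow> (nat \<Rightarrow> int) \<times> ((nat \<Rightarrow> int) \<Rightarrow> (nat \<Rightarrow> int))"
  where "S_a p j k = (P_gen p j k, \<one>\<^bsub>b_group p j\<^esub>)"

definition S_b :: "nat \<Rightarrow> nat \<Rightarrow> (nat \<Rightarrow> int) \<times> ((nat \<Rightarrow> int) \<Rightarrow> (nat \<Rightarrow> int))"
  where "S_b p j = (\<one>\<^bsub>P_group p j\<^esub>, b_map p j)"


section \<open>Well-definedness\<close>

lemma comm_group_P: "comm_group (P_group p j)"
proof -
  have "group (P_group p j)"
    unfolding P_group_def by (rule product_group) simp
  then show ?thesis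
    by (rule group.group_comm_groupI) (auto simp: P_group_def add.commute)
qed

lemma group_P: "group (P_group p j)"
  using comm_group_P comm_group_def by blast

lemma carrier_P:
  assumes "p > 0"
  shows "carrier (P_group p j) = (\<Pi>\<^sub>E k \<in> P_index p j. {0..<int (P_ord p j k)})"
  unfolding P_group_def carrier_product_group
  by (rule PiE_cong) (use assms in \<open>simp add: carrier_integer_mod_group P_ord_def\<close>)

lemma finite_P:
  assumes "p > 0"
  shows "finite (carrier (P_group p j))"
  unfolding carrier_P[OF assms] by (rule finite_PiE) (auto simp: P_index_def)

lemma proj_hom:
  assumes "i \<in> P_index p j"
  shows "(\<lambda>x. x i) \<in> hom (P_group p j) (integer_mod_group (P_ord p j i))"
  using assms by (auto simp: hom_def P_group_def)

lemma P_mult_nth: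
  assumes "i \<in> P_index p j"
  shows "(x \<otimes>\<^bsub>P_group p j\<^esub> y) i = (x i + y i) mod int (P_ord p j i)"
  using assms by (simp add: P_group_def)

lemma P_inv_nth:
  assumes "i \<in> P_index p j" "x \<in> carrier (P_group p j)"
  shows "(inv\<^bsub>P_group p j\<^esub> x) i = (- x i) mod int (P_ord p j i)"
proof -
  have "x i \<in> carrier (integer_mod_group (P_ord p j i))"
    using assms by (auto simp: P_group_def)
  then show ?thesis
    using assms by (simp add: P_group_def)
qed

lemma P_int_pow_nth:
  assumes "i \<in> P_index p j" "x \<in> carrier (P_group p j)"
  shows "(x [^]\<^bsub>P_group p j\<^esub> (m :: int)) i = (m * x i) mod int (P_ord p j i)"
proof -
  have "(x [^]\<^bsub>P_group p j\<^esub> m) i = x i [^]\<^bsub>integer_mod_group (P_ord p j i)\<^esub> m"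
    using hom_int_pow[OF proj_hom[OF assms(1)] assms(2) group_P] by simp
  then show ?thesis
    by (simp add: int_pow_integer_mod_group)
qed

lemma P_finprod_nth:
  assumes "i \<in> P_index p j" "finite K" "f \<in> K \<rightarrow> carrier (P_group p j)"
  shows "(finprod (P_group p j) f K) i = (\<Sum>k\<in>K. f k i) mod int (P_ord p j i)"
proof -
  interpret P: comm_group "P_group p j" by (rule comm_group_P)
  show ?thesis
    using assms(2,3)
  proof (induction K rule: finite_induct)
    case empty
    then show ?case using assms(1) unfolding P.finprod_empty by (simp add: P_group_def)
  next
    case (insert k K)
    then have "finprod (P_group p j) f (insert k K) = f k \<otimes>\<^bsub>P_group p j\<^esub> finprod (P_group p j) f K"
      by (intro P.finprod_insert) auto
    with insert show ?case
      by (simp add: P_mult_nth[OF assms(1)] mod_simps)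
  qed
qed

lemma index_ge_3:
  assumes "p > 3" "j \<ge> 1"
  shows "p ^ j - 1 \<ge> (3::nat)"
proof -
  have "p ^ 1 \<le> p ^ j"
    by (rule power_increasing) (use assms in auto)
  then show ?thesis using assms by simp
qed

lemma P_gen_carrier:
  assumes "p > 1"
  shows "P_gen p j k \<in> carrier (P_group p j)"
proof -
  have "p ^ (j + 1) > 1"
    by (rule one_less_power) (use assms in auto)
  then have "1 < P_ord p j i" "0 < P_ord p j i" for i
    using assms by (auto simp: P_ord_def)
  then show ?thesis
    using assms by (auto simp: carrier_P P_gen_def)
qed

lemma b_image_carrier:
  assumes "p > 1"
  shows "b_image p j k \<in> carrier (P_group p j)"
proof -
  interpret P: comm_group "P_group p j" by (rule comm_group_P)
  show ?thesis
    using P_gen_carrier[OF assms] by (auto simp: b_image_def)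
qed

lemma b_image_nth:
  assumes "p > 1" "i \<in> P_index p j"
  shows "b_image p j k i mod int (P_ord p j i) =
     (if k = 1 then P_gen p j 1 i - P_gen p j 2 i
      else if k < p ^ j - 1 then P_gen p j k i + P_gen p j (k + 1) i
      else P_gen p j (p ^ j - 1) i - int (p ^ j) * P_gen p j 1 i) mod int (P_ord p j i)"
  using assms
  by (simp add: b_image_def P_mult_nth P_inv_nth P_int_pow_nth P_gen_carrier mod_simps)

lemma b_map_sum:
  assumes "p > 1" "q \<in> carrier (P_group p j)" "i \<in> P_index p j"
  shows "b_map p j q i = (\<Sum>k\<in>P_index p j. q k * b_image p j k i) mod int (P_ord p j i)"
proof -
  interpret P: comm_group "P_group p j" by (rule comm_group_P)
  have "b_map p j q i =
    (\<Sum>k\<in>P_index p j. (b_image p j k [^]\<^bsub>P_group p j\<^esub> q k) i) mod int (P_ord p j i)"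
    using assms b_image_carrier[OF assms(1)]
    by (simp add: b_map_def P_finprod_nth P_index_def)
  also have "\<dots> = (\<Sum>k\<in>P_index p j. q k * b_image p j k i) mod int (P_ord p j i)"
    using assms b_image_carrier[OF assms(1)]
    by (simp add: P_int_pow_nth mod_sum_eq)
  finally show ?thesis .
qed

lemma b_map_carrier:
  assumes "p > 1" "q \<in> carrier (P_group p j)"
  shows "b_map p j q \<in> carrier (P_group p j)"
proof -
  interpret P: comm_group "P_group p j" by (rule comm_group_P)
  show ?thesis
    using assms b_image_carrier[OF assms(1)] by (auto simp: b_map_def intro!: P.finprod_closed)
qed

lemma P_eqI:
  assumes "x \<in> carrier (P_group p j)" "y \<in> carrier (P_group p j)"
    and "\<And>i. i \<in> P_index p j \<Longrightarrow> x i = y i"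
  shows "x = y"
  using assms by (auto simp: P_group_def intro: PiE_ext)

lemma P_nth_mod:
  assumes "p > 0" "x \<in> carrier (P_group p j)" "i \<in> P_index p j"
  shows "x i mod int (P_ord p j i) = x i"
proof -
  have "x i \<in> {0..<int (P_ord p j i)}"
    using assms(2,3) unfolding carrier_P[OF assms(1)] by (rule PiE_mem)
  then show ?thesis by simp
qed

lemma b_map_gen:
  assumes "p > 1" "k \<in> P_index p j"
  shows "b_map p j (P_gen p j k) = b_image p j k"
proof (rule P_eqI)
  fix i assume i: "i \<in> P_index p j"
  have "(\<Sum>l\<in>P_index p j. P_gen p j k l * b_image p j l i) =
        (\<Sum>l\<in>P_index p j. if l = k then b_image p j l i else 0)"
    by (rule sum.cong) (auto simp: P_gen_def)
  also have "\<dots> = b_image p j k i"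
    using assms(2) by (simp add: P_index_def)
  finally show "b_map p j (P_gen p j k) i = b_image p j k i"
    using assms i by (simp add: b_map_sum P_gen_carrier P_nth_mod b_image_carrier)
qed (intro b_map_carrier P_gen_carrier b_image_carrier assms)+

lemma b_map_nth:
  assumes "p > 3" "j \<ge> 1" "q \<in> carrier (P_group p j)" "i \<in> P_index p j"
  shows "b_map p j q i =
    (q i + (if i = 1 then - int (p ^ j) * q (p ^ j - 1) else if i = 2 then - q 1 else q (i - 1)))
      mod int (P_ord p j i)"
proof -
  define m where "m = p ^ j - 1"
  define c where "c = int (p ^ j)"
  let ?n = "int (P_ord p j i)"
  have m: "m \<ge> 3" using index_ge_3 assms by (simp add: m_def)
  have p: "p > 1" using assms by simp
  have I: "P_index p j = {1..m}" by (simp add: P_index_def m_def)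
  have i: "1 \<le> i" "i \<le> m" using assms(4) by (auto simp: I)
  let ?r = "\<lambda>k. q k * (if k = 1 then P_gen p j 1 i - P_gen p j 2 i
      else if k < m then P_gen p j k i + P_gen p j (k + 1) i
      else P_gen p j m i - c * P_gen p j 1 i)"
  have "(\<Sum>k\<in>{1..m}. q k * b_image p j k i) mod ?n = (\<Sum>k\<in>{1..m}. ?r k) mod ?n"
  proof -
    have "q k * b_image p j k i mod ?n = ?r k mod ?n" for k
      using b_image_nth[OF p assms(4), of k]
      unfolding m_def[symmetric] c_def[symmetric] by (metis mod_mult_right_eq)
    then have "(\<Sum>k\<in>{1..m}. q k * b_image p j k i mod ?n) mod ?n = (\<Sum>k\<in>{1..m}. ?r k mod ?n) mod ?n"
      by (simp only:)
    then show ?thesis unfolding mod_sum_eq .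
  qed
  also have "(\<Sum>k\<in>{1..m}. ?r k) = (\<Sum>k\<in>{1..m}. (if k = i then q k else 0) +
     (if k = (if i = 1 then m else i - 1)
      then (if i = 1 then - c else if i = 2 then - 1 else 1) * q k else 0))"
    (is "_ = (\<Sum>k\<in>_. ?s k)")
  proof (rule sum.cong[OF refl])
    fix k assume "k \<in> {1..m}"
    then have k: "1 \<le> k" "k \<le> m" by auto
    have g: "P_gen p j l i = (if i = l then 1 else 0)" for l
      using assms(4) by (simp add: P_gen_def)
    consider "k = 1" | "k \<noteq> 1" "k < m" | "k = m" using k by linarith
    then show "?r k = ?s k"
    proof cases
      case 1
      then show ?thesis using m i by (auto simp: g)
    next
      case 2
      then show ?thesis using m i k by (auto simp: g)
    next
      case 3
      then show ?thesis using m i by (auto simp: g)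
    qed
  qed
  also have "\<dots> = q i + (if i = 1 then - c * q m else if i = 2 then - q 1 else q (i - 1))"
    using i m unfolding sum.distrib by auto
  finally show ?thesis
    using b_map_sum[OF p assms(3,4)] unfolding I m_def c_def by metis
qed

lemma b_map_hom:
  assumes "p > 3" "j \<ge> 1"
  shows "b_map p j \<in> hom (P_group p j) (P_group p j)"
proof (rule homI)
  interpret P: comm_group "P_group p j" by (rule comm_group_P)
  have p: "p > 1" using assms by simp
  show "b_map p j x \<in> carrier (P_group p j)" if "x \<in> carrier (P_group p j)" for x
    using b_map_carrier[OF p that] .
  fix x y assume xy: "x \<in> carrier (P_group p j)" "y \<in> carrier (P_group p j)"
  define m where "m = p ^ j - 1"
  define c where "c = int (p ^ j)"
  have m: "m \<ge> 3" using index_ge_3 assms by (simp add: m_def)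
  show "b_map p j (x \<otimes>\<^bsub>P_group p j\<^esub> y) = b_map p j x \<otimes>\<^bsub>P_group p j\<^esub> b_map p j y"
  proof (rule P_eqI)
    fix i assume i: "i \<in> P_index p j"
    let ?n = "int (P_ord p j i)"
    let ?t = "\<lambda>q. if i = 1 then - c * q m else if i = 2 then - q 1 else q (i - 1)"
    have t: "?t (x \<otimes>\<^bsub>P_group p j\<^esub> y) mod ?n = (?t x + ?t y) mod ?n"
    proof (cases "i = 1")
      case True
      have mm: "m \<in> P_index p j" using m by (simp add: P_index_def m_def)
      have n: "?n = c * int p" and pm: "P_ord p j m = p"
        using True m by (simp_all add: P_ord_def c_def)
      have "c * ((x m + y m) mod int p) = (c * (x m + y m)) mod ?n"
        unfolding n by (rule mod_mult_mult1[symmetric])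
      then have "(- (c * ((x m + y m) mod int p))) mod ?n = (- (c * (x m + y m))) mod ?n"
        by (metis mod_minus_eq)
      moreover have "- (c * (x m + y m)) = - c * x m + - c * y m"
        by (simp add: distrib_left)
      ultimately show ?thesis
        using True by (simp add: P_mult_nth[OF mm] pm)
    next
      case False
      then have n: "?n = int p" by (simp add: P_ord_def)
      have dv: "int p dvd int (P_ord p j l)" for l by (simp add: P_ord_def)
      have one: "1 \<in> P_index p j" using m by (simp add: P_index_def m_def)
      have im: "i - 1 \<in> P_index p j" using i False by (auto simp: P_index_def)
      show ?thesis
      proof (cases "i = 2")
        case True
        have "(- ((x 1 + y 1) mod int (P_ord p j 1))) mod int p = (- (x 1 + y 1)) mod int p"
          by (metis dv mod_minus_eq mod_mod_cancel)
        then show ?thesis using True n by (simp only: P_mult_nth[OF one]) simp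
      next
        case False
        then show ?thesis
          using \<open>i \<noteq> 1\<close> n by (simp only: P_mult_nth[OF im] if_False mod_mod_cancel[OF dv])
      qed
    qed
    have "b_map p j (x \<otimes>\<^bsub>P_group p j\<^esub> y) i =
          ((x \<otimes>\<^bsub>P_group p j\<^esub> y) i + ?t (x \<otimes>\<^bsub>P_group p j\<^esub> y)) mod ?n"
      using b_map_nth[OF assms P.m_closed[OF xy] i] unfolding m_def c_def .
    also have "\<dots> = ((x i + y i) + ?t (x \<otimes>\<^bsub>P_group p j\<^esub> y) mod ?n) mod ?n"
      by (simp only: P_mult_nth[OF i] mod_simps)
    also have "\<dots> = ((x i + ?t x) + (y i + ?t y)) mod ?n"
      unfolding t mod_add_right_eq by (simp only: add.assoc add.left_commute)
    also have "\<dots> = (b_map p j x \<otimes>\<^bsub>P_group p j\<^esub> b_map p j y) i"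
      by (simp only: P_mult_nth[OF i] b_map_nth[OF assms xy(1) i] b_map_nth[OF assms xy(2) i] m_def c_def mod_simps)
    finally show "b_map p j (x \<otimes>\<^bsub>P_group p j\<^esub> y) i = (b_map p j x \<otimes>\<^bsub>P_group p j\<^esub> b_map p j y) i" .
  qed (intro b_map_carrier P.m_closed p xy)+
qed

lemma b_map_inj:
  assumes "p > 3" "j \<ge> 1"
  shows "inj_on (b_map p j) (carrier (P_group p j))"
proof -
  interpret b: group_hom "P_group p j" "P_group p j" "b_map p j"
    using b_map_hom[OF assms] by (simp add: group_hom_def group_hom_axioms_def group_P)
  let ?m = "p ^ j - 1"
  have m: "?m \<ge> 3" using index_ge_3 assms by blast
  have p0: "p > 0" using assms by simp
  show ?thesis
    unfolding b.inj_on_one_iff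
  proof (intro allI impI)
    fix x assume x: "x \<in> carrier (P_group p j)" and bx: "b_map p j x = \<one>\<^bsub>P_group p j\<^esub>"
    have z: "b_map p j x i = 0" if "i \<in> P_index p j" for i
      using that by (simp add: bx P_group_def)
    note eq = b_map_nth[OF assms x, unfolded z]
    have rng: "x i mod int (P_ord p j i) = x i" if "i \<in> P_index p j" for i
      using P_nth_mod[OF p0 x that] .
    have zero: "x i = 0" if "i \<in> P_index p j" "int (P_ord p j i) dvd x i" for i
      using that rng[of i] by auto
    have "int (p ^ (j + 1)) dvd x 1 - int (p ^ j) * x ?m"
      using eq[of 1] z[of 1] m by (auto simp: P_index_def P_ord_def mod_eq_0_iff_dvd)
    moreover have "int (p ^ j) dvd int (p ^ (j + 1))" by simp
    ultimately have "int (p ^ j) dvd x 1 - int (p ^ j) * x ?m"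
      by (rule dvd_trans[rotated])
    then have "int (p ^ j) dvd x 1"
      by (simp add: dvd_diff_left_iff)
    moreover have "int p dvd int (p ^ j)" using assms(2) by (simp add: dvd_power)
    ultimately have d1: "int p dvd x 1" by (rule dvd_trans[rotated])
    have x2: "x k = 0" if "2 \<le> k" "k \<le> ?m" for k
      using that
    proof (induction k rule: dec_induct)
      case base
      have i: "2 \<in> P_index p j" using m by (simp add: P_index_def)
      have "int p dvd x 2 - x 1"
        using eq[OF i] z[OF i] by (simp add: P_ord_def mod_eq_0_iff_dvd)
      then have "int p dvd x 2" using d1 by (simp add: dvd_diff_left_iff)
      then show ?case using zero[OF i] by (simp add: P_ord_def)
    next
      case (step k)
      have i: "Suc k \<in> P_index p j" using step by (simp add: P_index_def)
      have "int p dvd x (Suc k) + x k"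
        using eq[OF i] z[OF i] step by (simp add: P_ord_def mod_eq_0_iff_dvd)
      then have "int p dvd x (Suc k)" using step by simp
      then show ?case using zero[OF i] step by (simp add: P_ord_def)
    qed
    have i1: "1 \<in> P_index p j" using m by (simp add: P_index_def)
    have "x 1 = 0"
      using eq[OF i1] z[OF i1] x2[of ?m] m rng[OF i1] by simp
    then show "x = \<one>\<^bsub>P_group p j\<^esub>"
      using x2 by (intro P_eqI[OF x]) (auto simp: P_group_def P_index_def, metis Suc_leI le_neq_implies_less numeral_2_eq_2)
  qed
qed

lemma b_map_auto:
  assumes "p > 3" "j \<ge> 1"
  shows "b_map p j \<in> carrier (AutoGroup (P_group p j))"
proof -
  have p: "p > 0" "p > 1" using assms by auto
  have "b_map p j ` carrier (P_group p j) = carrier (P_group p j)"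
    using b_map_carrier[OF p(2)]
    by (intro card_subset_eq finite_P p card_image b_map_inj assms) auto
  then have "bij_betw (b_map p j) (carrier (P_group p j)) (carrier (P_group p j))"
    using b_map_inj[OF assms] by (simp add: bij_betw_def)
  moreover have "b_map p j \<in> extensional (carrier (P_group p j))"
    by (simp add: b_map_def)
  ultimately show ?thesis
    using b_map_hom[OF assms] by (simp add: AutoGroup_def auto_def Bij_def)
qed

lemma group_b_group: "group (b_group p j)"
  unfolding b_group_def
  by (rule group.group_subgroup_generated[OF group.AutoGroup[OF group_P]])

lemma b_group_auto:
  "carrier (b_group p j) \<subseteq> auto (P_group p j)"
  using group.carrier_subgroup_generated_subset[OF group.AutoGroup[OF group_P]]
  by (fastforce simp: b_group_def AutoGroup_def)

lemma b_map_in_b_group: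
  assumes "p > 3" "j \<ge> 1"
  shows "b_map p j \<in> carrier (b_group p j)"
  using b_map_auto[OF assms] by (simp add: b_group_def carrier_subgroup_generated generate.incl)

lemma group_S_group: "group (S_group p j)"
  unfolding S_group_def
proof (rule group_semidirect_product[OF group_P group_b_group])
  fix h h' q
  assume h: "h \<in> carrier (b_group p j)"
  then have ha: "h \<in> auto (P_group p j)" using b_group_auto by blast
  then show "h \<in> hom (P_group p j) (P_group p j)" by (simp add: auto_def)
  assume h': "h' \<in> carrier (b_group p j)" and q: "q \<in> carrier (P_group p j)"
  then have "h' \<in> auto (P_group p j)" using b_group_auto by blast
  then show "(h \<otimes>\<^bsub>b_group p j\<^esub> h') q = h (h' q)"
    using ha q
    by (simp add: b_group_def subgroup_generated_def AutoGroup_def BijGroup_def auto_def compose_def)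
next
  fix q assume "q \<in> carrier (P_group p j)"
  then show "\<one>\<^bsub>b_group p j\<^esub> q = q"
    by (simp add: b_group_def AutoGroup_def BijGroup_def)
qed

lemma finite_S_group:
  assumes "p > 0"
  shows "finite (carrier (S_group p j))"
proof -
  have "carrier (b_group p j) \<subseteq> (\<Pi>\<^sub>E q \<in> carrier (P_group p j). carrier (P_group p j))"
  proof
    fix f assume "f \<in> carrier (b_group p j)"
    then have "f \<in> Bij (carrier (P_group p j))"
      using b_group_auto[of p j] by (auto simp: auto_def)
    then show "f \<in> (\<Pi>\<^sub>E q \<in> carrier (P_group p j). carrier (P_group p j))"
      unfolding PiE_def using Bij_imp_extensional Bij_imp_funcset by blast
  qed
  then have "finite (carrier (b_group p j))"
    by (rule finite_subset) (intro finite_PiE finite_P assms)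
  then show ?thesis
    using finite_P[OF assms] by (simp add: S_group_def semidirect_product_def)
qed

lemma S_a_carrier:
  assumes "p > 1"
  shows "S_a p j k \<in> carrier (S_group p j)"
  using P_gen_carrier[OF assms] group.is_monoid[OF group_b_group]
  by (simp add: S_a_def S_group_def semidirect_product_def monoid.one_closed)

lemma S_b_carrier:
  assumes "p > 3" "j \<ge> 1"
  shows "S_b p j \<in> carrier (S_group p j)"
  using b_map_in_b_group[OF assms] group.is_monoid[OF group_P]
  by (simp add: S_b_def S_group_def semidirect_product_def monoid.one_closed)

text \<open>Conjugation by \<open>b\<close> is the automorphism \<open>b\<close>, in the form \<open>b q = b(q) b\<close>.\<close>

lemma S_b_conj:
  assumes "p > 3" "j \<ge> 1" "q \<in> carrier (P_group p j)"
  shows "S_b p j \<otimes>\<^bsub>S_group p j\<^esub> (q, \<one>\<^bsub>b_group p j\<^esub>)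
       = (b_map p j q, \<one>\<^bsub>b_group p j\<^esub>) \<otimes>\<^bsub>S_group p j\<^esub> S_b p j"
proof -
  interpret P: comm_group "P_group p j" by (rule comm_group_P)
  interpret B: group "b_group p j" by (rule group_b_group)
  have b: "b_map p j \<in> carrier (b_group p j)" and c: "b_map p j q \<in> carrier (P_group p j)"
    using assms b_map_in_b_group b_map_carrier by auto
  have "\<one>\<^bsub>b_group p j\<^esub> \<one>\<^bsub>P_group p j\<^esub> = \<one>\<^bsub>P_group p j\<^esub>"
    using P.one_closed by (simp add: b_group_def AutoGroup_def BijGroup_def)
  with b c show ?thesis
    by (simp add: S_b_def S_group_def semidirect_product_def)
qed

end

theory Submission
  imports Defs "HOL-Number_Theory.Cong" "HOL-Algebra.Multiplicative_Group"
begin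

text \<open>
  Let \<open>n = p\<^sup>j\<close>, and write the abelian group \<open>P\<close> additively. The \<open>n\<close>-th power of an element
  \<open>(q, b\<^sup>k)\<close> of \<open>S(p,j)\<close> has trivial second component, and its first component is the sum of
  \<open>b\<^sup>k\<^sup>i q\<close> over \<open>i < n\<close>. The heart of the proof is that this sum depends only on the exponent
  \<open>q 1\<close> of \<open>a\<^sub>1\<close> in \<open>q\<close> and on whether \<open>p\<close> divides \<open>k\<close> (lemma \<open>S_pow_n\<close>):
  \<open>(q, b\<^sup>k)\<^sup>n = a\<^sub>1\<close> to the power \<open>\<epsilon> n (q 1)\<close>, where \<open>\<epsilon> = 1\<close> if \<open>p\<close> divides \<open>k\<close> and \<open>\<epsilon> = 2\<close>
  otherwise.

  If \<open>p\<close> does not divide \<open>k\<close>, then \<open>b\<^sup>k\<close> generates the group of \<open>b\<close>, which allows \<open>k = 1\<close>. Put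
  \<open>N = b - 1\<close>. Up to signs, \<open>N\<close> shifts \<open>a\<^sub>1\<close> to \<open>a\<^sub>2\<close>, and so on up to \<open>a\<^sub>n\<^sub>-\<^sub>1\<close>, which goes to
  \<open>n a\<^sub>1\<close>; its image is killed by \<open>p\<close>. The sum of the \<open>b\<^sup>i\<close> is the sum of
  \<open>(n choose (i + 1)) N\<^sup>i\<close>. As \<open>p\<close> divides the inner binomial coefficients, only the two ends
  survive: \<open>n q\<close>, and \<open>N\<^sup>n\<^sup>-\<^sup>1 q\<close>. Both are equal to \<open>n (q 1) a\<^sub>1\<close>, whence the factor 2.
  If \<open>p\<close> divides \<open>k\<close>, then every element of the orbit is repeated a multiple of \<open>p\<close> times, and
  \<open>p N = 0\<close> leaves only \<open>n q\<close>.

  Now let \<open>u = b a\<^sub>1\<close> and let \<open>a u\<^sup>-\<^sup>1 = (r, b\<^sup>k)\<close>. Then \<open>a\<close> has the form \<open>(q, b\<^sup>k\<^sup>+\<^sup>1)\<close> with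
  \<open>q 1 \<equiv> r 1 + 1\<close> modulo \<open>p\<close>. With \<open>x = r 1\<close>, membership of \<open>a\<close> in the set for \<open>a\<^sub>1\<close> to the power
  \<open>t n\<close> says \<open>\<epsilon> x \<equiv> t \<equiv> \<epsilon>' (x + 1)\<close> modulo \<open>p\<close> (lemma \<open>in_G_set_iff\<close>), where \<open>\<epsilon>, \<epsilon>' \<in> {1, 2}\<close>
  belong to \<open>k\<close> and \<open>k + 1\<close> and are not both 1. The pair \<open>(2, 2)\<close> forces \<open>p\<close> to divide 2, the pair
  \<open>(1, 2)\<close> gives \<open>t \<equiv> -2\<close>, and the pair \<open>(2, 1)\<close> gives \<open>t \<equiv> 2\<close>. For \<open>p > 3\<close> the value \<open>t = 1\<close> is
  neither, while \<open>t = 2\<close> is attained. Since \<open>S(p,j)\<close> has odd order, the exponent 2 is coprime to it,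
  and the two sets together refute the \<open>FSZ\<close> property.
\<close>

section \<open>Pascal recursions modulo a prime\<close>

text \<open>\<open>k\<close> times the binomial coefficient is a multiple of \<open>p\<^sup>j\<close>, which does not divide \<open>k\<close>.\<close>

lemma prime_dvd_prime_power_choose:
  fixes p :: nat
  assumes "prime p" "0 < k" "k < p ^ j"
  shows "p dvd (p ^ j choose k)"
proof (rule ccontr)
  assume "\<not> p dvd (p ^ j choose k)"
  then have "coprime (p ^ j) (p ^ j choose k)"
    using assms(1) by (simp add: prime_imp_coprime)
  moreover have "p ^ j dvd k * (p ^ j choose k)"
    using times_binomial_minus1_eq[OF assms(2), of "p ^ j"] by simp
  ultimately have "p ^ j dvd k"
    using coprime_dvd_mult_left_iff by blast
  then show False
    using assms(2,3) by (auto dest: dvd_imp_le)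
qed

lemma sum_choose_lessThan: "(\<Sum>i<n. i choose l) = n choose Suc l"
  by (induction n) auto

text \<open>Each summation over the row index \<open>i\<close> raises the lower index of the binomial coefficients by
  one, so that iterated partial sums of an array of binomial type stay of this type.\<close>

lemma sum_choose_convolution:
  fixes c :: "nat \<Rightarrow> int"
  shows "(\<Sum>i<n. \<Sum>l\<le>k. int (i choose (l + d)) * c l) = (\<Sum>l\<le>k. int (n choose (l + Suc d)) * c l)"
  by (subst sum.swap) (simp flip: sum_distrib_right of_nat_sum add: sum_choose_lessThan)

text \<open>The rows of \<open>z\<close> are the iterates of \<open>1 + N\<close>, where \<open>N\<close> is the shift of the columns by one, so
  this is the binomial expansion of the powers of \<open>1 + N\<close>.\<close>

lemma pascal_array_cong:
  fixes z :: "nat \<Rightarrow> nat \<Rightarrow> int"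
  assumes first: "\<And>i. [z (Suc i) 0 = z i 0] (mod p)"
    and step: "\<And>i k. Suc k < m \<Longrightarrow> [z (Suc i) (Suc k) = z i (Suc k) + z i k] (mod p)"
    and "k < m"
  shows "[z i k = (\<Sum>l\<le>k. int (i choose l) * z 0 (k - l))] (mod p)"
  using \<open>k < m\<close>
proof (induction i arbitrary: k)
  case 0
  have "(\<Sum>l\<le>k. int (0 choose l) * z 0 (k - l)) = (\<Sum>l\<le>k. if l = 0 then z 0 k else 0)"
    by (rule sum.cong) (auto simp: binomial_eq_0)
  then show ?case by simp
next
  case (Suc i)
  show ?case
  proof (cases k)
    case 0
    then show ?thesis using Suc.IH[of 0] Suc.prems first[of i] by (auto intro: cong_trans)
  next
    case (Suc k')
    have "[z (Suc i) k = z i k + z i k'] (mod p)"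
      using step[of k' i] Suc Suc.prems by simp
    also have "[z i k + z i k' = (\<Sum>l\<le>k. int (i choose l) * z 0 (k - l))
        + (\<Sum>l\<le>k'. int (i choose l) * z 0 (k' - l))] (mod p)"
      using Suc Suc.prems by (intro cong_add Suc.IH) auto
    also have "(\<Sum>l\<le>k. int (i choose l) * z 0 (k - l)) + (\<Sum>l\<le>k'. int (i choose l) * z 0 (k' - l))
        = (\<Sum>l\<le>k. int (Suc i choose l) * z 0 (k - l))"
      unfolding Suc sum.atMost_Suc_shift by (simp add: sum.distrib distrib_right)
    finally show ?thesis .
  qed
qed

text \<open>After \<open>p\<^sup>j\<close> rows, or after summing over so many rows once or twice, the binomial coefficients
  of \<open>p\<^sup>j\<close> occur with lower indices \<open>l\<close>, \<open>l + 1\<close> and \<open>l + 2\<close>. The only ones that do not vanish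
  modulo \<open>p\<close> have lower index 0 or \<open>p\<^sup>j\<close>. The former occurs only in the first case, and the latter
  only in the third, and there only in the last column: its contribution \<open>z 0 0\<close> is what
  distinguishes the sum over the powers of \<open>b\<close> from \<open>p\<^sup>j\<close> times the identity.\<close>

lemma pascal_array_prime_power:
  fixes z :: "nat \<Rightarrow> nat \<Rightarrow> int" and p :: nat
  assumes p: "prime p"
    and first: "\<And>i. [z (Suc i) 0 = z i 0] (mod int p)"
    and step: "\<And>i k. Suc k < p ^ j - 1 \<Longrightarrow> [z (Suc i) (Suc k) = z i (Suc k) + z i k] (mod int p)"
    and k: "k < p ^ j - 1"
  shows pascal_array_period: "[z (p ^ j) k = z 0 k] (mod int p)"
    and pascal_array_sum: "[(\<Sum>i<p ^ j. z i k) = 0] (mod int p)"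
    and pascal_array_double_sum:
      "[(\<Sum>i<p ^ j. \<Sum>s<i. z s k) = (if Suc k = p ^ j - 1 then z 0 0 else 0)] (mod int p)"
proof -
  let ?n = "p ^ j"
  have formula: "[z i k = (\<Sum>l\<le>k. int (i choose (l + 0)) * z 0 (k - l))] (mod int p)" for i
    using pascal_array_cong[where z = z, OF first step k] by simp
  have vanish: "[int (?n choose l) = 0] (mod int p)" if "0 < l" "l < ?n" for l
    using prime_dvd_prime_power_choose[OF p that] by (simp add: cong_0_iff)
  note formula[of ?n]
  also have "[(\<Sum>l\<le>k. int (?n choose (l + 0)) * z 0 (k - l))
      = (\<Sum>l\<le>k. if l = 0 then z 0 k else 0)] (mod int p)"
    using k by (intro cong_sum) (auto intro!: cong_mult_self_left cong_scalar_right[OF vanish, simplified])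
  finally show "[z ?n k = z 0 k] (mod int p)" by simp
  have row: "[(\<Sum>i<N. z i k) = (\<Sum>l\<le>k. int (N choose (l + Suc 0)) * z 0 (k - l))] (mod int p)" for N
    using cong_sum[of "{..<N}" "\<lambda>i. z i k", OF formula] unfolding sum_choose_convolution .
  note row[of ?n]
  also have "[(\<Sum>l\<le>k. int (?n choose (l + Suc 0)) * z 0 (k - l)) = (\<Sum>l\<le>k. 0)] (mod int p)"
    using k by (intro cong_sum) (auto intro!: cong_scalar_right[OF vanish, simplified])
  finally show "[(\<Sum>i<?n. z i k) = 0] (mod int p)" by simp
  have "[(\<Sum>i<?n. \<Sum>s<i. z s k) = (\<Sum>l\<le>k. int (?n choose (l + Suc (Suc 0))) * z 0 (k - l))] (mod int p)"
    using cong_sum[of "{..<?n}" "\<lambda>i. \<Sum>s<i. z s k", OF row] unfolding sum_choose_convolution .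
  also have "[(\<Sum>l\<le>k. int (?n choose (l + Suc (Suc 0))) * z 0 (k - l))
      = (\<Sum>l\<le>k. if l = k \<and> Suc k = ?n - 1 then z 0 0 else 0)] (mod int p)"
  proof (rule cong_sum)
    fix l assume l: "l \<in> {..k}"
    show "[int (?n choose (l + Suc (Suc 0))) * z 0 (k - l)
      = (if l = k \<and> Suc k = ?n - 1 then z 0 0 else 0)] (mod int p)"
    proof (cases "l = k \<and> Suc k = ?n - 1")
      case True
      then have "l + Suc (Suc 0) = ?n" using k by linarith
      then show ?thesis using True by simp
    next
      case False
      then show ?thesis
        using l k by (auto intro!: cong_scalar_right[OF vanish, simplified])
    qed
  qed
  also have "(\<Sum>l\<le>k. if l = k \<and> Suc k = ?n - 1 then z 0 0 else 0)
      = (if Suc k = ?n - 1 then z 0 0 else 0)"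
    by simp
  finally show "[(\<Sum>i<?n. \<Sum>s<i. z s k) = (if Suc k = ?n - 1 then z 0 0 else 0)] (mod int p)" .
qed

section \<open>Sums of periodic functions along arithmetic progressions\<close>

lemma periodic_mod:
  fixes h :: "nat \<Rightarrow> 'a"
  assumes "\<And>i. h (i + n) = h i"
  shows "h (i mod n) = h i"
proof -
  have "h (a + n * t) = h a" for a t
    by (induction t) (use assms[of "a + n * _"] in \<open>auto simp: algebra_simps\<close>)
  from this[of "i mod n" "i div n"] show ?thesis by simp
qed

lemma sum_periodic_coprime:
  fixes h :: "nat \<Rightarrow> int"
  assumes per: "\<And>i. h (i + n) = h i" and "coprime k n"
  shows "(\<Sum>i<n. h (k * i)) = (\<Sum>i<n. h i)"
proof -
  have inj: "inj_on (\<lambda>i. k * i mod n) {..<n}"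
  proof (rule inj_onI)
    fix x y assume "x \<in> {..<n}" "y \<in> {..<n}" "k * x mod n = k * y mod n"
    then show "x = y"
      using cong_mult_lcancel_nat[OF assms(2), of x y] by (simp add: cong_def)
  qed
  have img: "(\<lambda>i. k * i mod n) ` {..<n} = {..<n}"
    by (rule card_subset_eq) (use card_image[OF inj] in auto)
  have "(\<Sum>i<n. h (k * i)) = (\<Sum>i<n. h (k * i mod n))"
    by (simp add: periodic_mod[of h, OF per])
  also have "\<dots> = (\<Sum>i<n. h i)"
    using sum.reindex[OF inj, of h] by (simp add: img)
  finally show ?thesis .
qed

lemma sum_periodic_blocks:
  fixes h :: "nat \<Rightarrow> int"
  assumes "\<And>i. h (i + d) = h i"
  shows "(\<Sum>i<e * d. h i) = int e * (\<Sum>i<d. h i)"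
proof -
  have "sum h {m * d..<m * d + d} = (\<Sum>i<d. h i)" for m
  proof -
    have "h (i + m * d) = h i" for i
      using periodic_mod[of h d, OF assms] by (metis mod_mult_self1)
    then show ?thesis
      using sum.shift_bounds_nat_ivl[of h 0 "m * d" d] by (simp add: add.commute lessThan_atLeast0)
  qed
  then show ?thesis
    unfolding sum.nat_group[symmetric] by simp
qed

section \<open>Sums over the orbits of the automorphism\<close>

locale S_parameters =
  fixes p j :: nat
  assumes prime: "prime p" and p_gt_3: "p > 3" and j_pos: "j \<ge> 1"
begin

definition n :: nat where "n = p ^ j"
definition a1 :: "nat \<Rightarrow> int" where "a1 = P_gen p j 1"

text \<open>On the first coordinate, the sum of the \<open>b\<^sup>k\<^sup>i\<close> over \<open>i < n\<close> acts as \<open>n\<close> times this factor.\<close>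

definition norm_factor :: "nat \<Rightarrow> int" where
  "norm_factor k = (if p dvd k then 1 else 2)"

abbreviation "P \<equiv> P_group p j"
abbreviation "B \<equiv> b_group p j"
abbreviation "S \<equiv> S_group p j"
abbreviation "b \<equiv> b_map p j"

sublocale P: comm_group P by (rule comm_group_P)
sublocale B: group B by (rule group_b_group)
sublocale S: group S by (rule group_S_group)

lemma p_gt_1: "p > 1" and p_pos: "p > 0"
  using p_gt_3 by auto

lemma n_ge_4: "n \<ge> 4"
  using index_ge_3[OF p_gt_3 j_pos] by (simp add: n_def)

lemma P_ord_first: "int (P_ord p j 1) = int p * int n"
  by (simp add: P_ord_def n_def)

lemma P_ord_other: "c \<noteq> 1 \<Longrightarrow> P_ord p j c = p"
  by (simp add: P_ord_def)

lemma p_dvd_n: "p dvd n"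
  using j_pos by (simp add: n_def dvd_power)

lemma P_index_iff: "c \<in> P_index p j \<longleftrightarrow> c = 1 \<or> 2 \<le> c \<and> c < n"
  using n_ge_4 by (auto simp: P_index_def n_def)

lemma P_eq_congI:
  assumes "x \<in> carrier P" "y \<in> carrier P" "[x 1 = y 1] (mod (int p * int n))"
    and "\<And>c. 2 \<le> c \<Longrightarrow> c < n \<Longrightarrow> [x c = y c] (mod int p)"
  shows "x = y"
proof (rule P_eqI[OF assms(1,2)])
  fix c assume c: "c \<in> P_index p j"
  then have "[x c = y c] (mod int (P_ord p j c))"
    using assms(3,4) P_ord_first P_ord_other[of c] by (auto simp: P_index_iff)
  then show "x c = y c"
    using P_nth_mod[OF p_pos assms(1) c] P_nth_mod[OF p_pos assms(2) c] by (simp add: cong_def)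
qed

lemma b_first: "q \<in> carrier P \<Longrightarrow> [b q 1 = q 1 - int n * q (n - 1)] (mod (int p * int n))"
  using b_map_nth[OF p_gt_3 j_pos, of q 1, folded n_def] P_ord_first by (simp add: P_index_iff cong_def)

lemma b_second: "q \<in> carrier P \<Longrightarrow> [b q 2 = q 2 - q 1] (mod int p)"
  using b_map_nth[OF p_gt_3 j_pos, of q 2] n_ge_4 P_ord_other[of 2] by (simp add: P_index_iff cong_def)

lemma b_later: "q \<in> carrier P \<Longrightarrow> 3 \<le> c \<Longrightarrow> c < n \<Longrightarrow> [b q c = q c + q (c - 1)] (mod int p)"
  using b_map_nth[OF p_gt_3 j_pos, of q c] P_ord_other[of c] by (simp add: P_index_iff cong_def)

lemma b_iter_carrier: "q \<in> carrier P \<Longrightarrow> (b ^^ i) q \<in> carrier P"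
  by (induction i) (auto simp: b_map_carrier[OF p_gt_1])

text \<open>The first coordinate is needed modulo \<open>p n\<close>, beyond the reach of the recursion modulo \<open>p\<close>. But
  \<open>b\<close> changes it by a multiple of \<open>n\<close>, so the other coordinates enter with a factor \<open>n\<close> and are
  needed only modulo \<open>p\<close>.\<close>

lemma b_iter_first:
  assumes "q \<in> carrier P"
  shows "[(b ^^ i) q 1 = q 1 - int n * (\<Sum>s<i. (b ^^ s) q (n - 1))] (mod (int p * int n))"
proof (induction i)
  case (Suc i)
  have "[(b ^^ Suc i) q 1 = (b ^^ i) q 1 - int n * (b ^^ i) q (n - 1)] (mod (int p * int n))"
    using b_first[OF b_iter_carrier[OF assms]] by simp
  also have "[(b ^^ i) q 1 - int n * (b ^^ i) q (n - 1)
      = q 1 - int n * (\<Sum>s<i. (b ^^ s) q (n - 1)) - int n * (b ^^ i) q (n - 1)] (mod (int p * int n))"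
    by (intro cong_diff Suc cong_refl)
  finally show ?case by (simp add: algebra_simps)
qed simp

lemma b_iter_first_mod_n:
  assumes "q \<in> carrier P"
  shows "[(b ^^ i) q 1 = q 1] (mod int n)"
proof -
  have "[(b ^^ i) q 1 = q 1 - int n * (\<Sum>s<i. (b ^^ s) q (n - 1))] (mod int n)"
    using b_iter_first[OF assms] by (rule cong_dvd_modulus) simp
  also have "[q 1 - int n * (\<Sum>s<i. (b ^^ s) q (n - 1)) = q 1] (mod int n)"
    by (simp add: cong_iff_dvd_diff)
  finally show ?thesis .
qed

text \<open>With the sign of the first coordinate reversed, and the columns numbered from 0, the coordinates
  of the iterates obey a Pascal recursion without signs.\<close>

definition iter_array :: "(nat \<Rightarrow> int) \<Rightarrow> nat \<Rightarrow> nat \<Rightarrow> int" where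
  "iter_array q i k = (if k = 0 then - (b ^^ i) q 1 else (b ^^ i) q (Suc k))"

lemma iter_array_first:
  assumes "q \<in> carrier P"
  shows "[iter_array q (Suc i) 0 = iter_array q i 0] (mod int p)"
proof -
  have d: "int p dvd int n" using p_dvd_n by simp
  have "[(b ^^ Suc i) q 1 = (b ^^ i) q 1] (mod int n)"
    using b_iter_first_mod_n[OF assms] by (meson cong_sym cong_trans)
  then have "[(b ^^ Suc i) q 1 = (b ^^ i) q 1] (mod int p)"
    by (rule cong_dvd_modulus[OF _ d])
  then show ?thesis
    by (simp add: iter_array_def cong_minus_minus_iff)
qed

lemma iter_array_step:
  assumes "q \<in> carrier P" "Suc k < n - 1"
  shows "[iter_array q (Suc i) (Suc k) = iter_array q i (Suc k) + iter_array q i k] (mod int p)"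
  using b_second[OF b_iter_carrier[OF assms(1), of i]]
    b_later[OF b_iter_carrier[OF assms(1), of i], of "Suc (Suc k)"] assms(2)
  by (cases k) (simp_all add: iter_array_def numeral_2_eq_2)

lemma iter_array_collapse:
  assumes "q \<in> carrier P" "k < n - 1"
  shows iter_array_period: "[iter_array q n k = iter_array q 0 k] (mod int p)"
    and iter_array_sum: "[(\<Sum>i<n. iter_array q i k) = 0] (mod int p)"
    and iter_array_double_sum: "[(\<Sum>i<n. \<Sum>s<i. iter_array q s k)
      = (if Suc k = n - 1 then iter_array q 0 0 else 0)] (mod int p)"
  using pascal_array_prime_power[where z = "iter_array q" and p = p and j = j and k = k]
    prime iter_array_first[OF assms(1)] iter_array_step[OF assms(1)] assms(2)
  by (simp_all add: n_def)

lemma iter_array_Suc: "k \<noteq> 0 \<Longrightarrow> iter_array q i k = (b ^^ i) q (Suc k)"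
  by (simp add: iter_array_def)

lemma norm_later:
  assumes "q \<in> carrier P" "2 \<le> c" "c < n"
  shows "[(\<Sum>i<n. (b ^^ i) q c) = 0] (mod int p)"
  using iter_array_sum[OF assms(1), of "c - 1"] assms by (simp add: iter_array_Suc)

text \<open>One \<open>n (q 1)\<close> comes from the \<open>n\<close> summands \<open>q 1\<close>, the other one from the double sum over the
  last coordinate, which is \<open>- q 1\<close> modulo \<open>p\<close>.\<close>

lemma norm_first:
  assumes "q \<in> carrier P"
  shows "[(\<Sum>i<n. (b ^^ i) q 1) = int n * (2 * q 1)] (mod (int p * int n))"
proof -
  have "[(\<Sum>i<n. \<Sum>s<i. (b ^^ s) q (n - 1)) = - q 1] (mod int p)"
    using iter_array_double_sum[OF assms, of "n - 2"] n_ge_4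
    by (simp add: iter_array_def Suc_diff_Suc numeral_2_eq_2)
  then have "[int n * (\<Sum>i<n. \<Sum>s<i. (b ^^ s) q (n - 1)) = int n * - q 1] (mod (int n * int p))"
    by (rule cong_cmult_leftI)
  then have D: "[int n * (\<Sum>i<n. \<Sum>s<i. (b ^^ s) q (n - 1)) = int n * - q 1] (mod (int p * int n))"
    by (simp add: mult.commute)
  have "[(\<Sum>i<n. (b ^^ i) q 1) = (\<Sum>i<n. q 1 - int n * (\<Sum>s<i. (b ^^ s) q (n - 1)))] (mod (int p * int n))"
    by (intro cong_sum b_iter_first assms)
  also have "(\<Sum>i<n. q 1 - int n * (\<Sum>s<i. (b ^^ s) q (n - 1)))
      = int n * q 1 - int n * (\<Sum>i<n. \<Sum>s<i. (b ^^ s) q (n - 1))"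
    by (simp add: sum_subtractf sum_distrib_left)
  also have "[\<dots> = int n * q 1 - int n * - q 1] (mod (int p * int n))"
    by (intro cong_diff cong_refl D)
  finally show ?thesis by (simp add: algebra_simps)
qed

text \<open>The first coordinate returns after \<open>n\<close> steps because the last coordinate sums to 0 modulo \<open>p\<close>
  over them; the other coordinates do so by the binomial expansion of \<open>b\<^sup>n\<close>.\<close>

lemma b_period:
  assumes "q \<in> carrier P"
  shows "(b ^^ n) q = q"
proof (rule P_eq_congI)
  have "[(\<Sum>i<n. (b ^^ i) q (n - 1)) = 0] (mod int p)"
    using norm_later[OF assms, of "n - 1"] n_ge_4 by simp
  then have "[int n * (\<Sum>i<n. (b ^^ i) q (n - 1)) = int n * 0] (mod (int n * int p))"
    by (rule cong_cmult_leftI)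
  then have D: "[int n * (\<Sum>i<n. (b ^^ i) q (n - 1)) = 0] (mod (int p * int n))"
    by (simp add: mult.commute)
  have "[q 1 - int n * (\<Sum>i<n. (b ^^ i) q (n - 1)) = q 1 - 0] (mod (int p * int n))"
    by (intro cong_diff cong_refl D)
  with b_iter_first[OF assms] show "[(b ^^ n) q 1 = q 1] (mod (int p * int n))"
    by (auto intro: cong_trans)
  show "[(b ^^ n) q c = q c] (mod int p)" if "2 \<le> c" "c < n" for c
    using iter_array_period[OF assms, of "c - 1"] that by (simp add: iter_array_Suc)
qed (intro b_iter_carrier assms)+

lemma b_iter_add_n: "q \<in> carrier P \<Longrightarrow> (b ^^ (i + n)) q = (b ^^ i) q"
  by (simp add: funpow_add b_period)

text \<open>For \<open>k\<close> prime to \<open>p\<close>, the exponents \<open>k i\<close> run through all residues modulo the period \<open>n\<close>. For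
  \<open>k\<close> divisible by \<open>p\<close>, the summands have period \<open>n / p\<close>, and the factor \<open>p\<close> that this yields lifts
  the congruence of the first coordinate modulo \<open>n\<close> to one modulo \<open>p n\<close>.\<close>

lemma norm_progression:
  assumes q: "q \<in> carrier P"
  shows norm_progression_first: "[(\<Sum>i<n. (b ^^ (k * i)) q 1)
      = int n * (norm_factor k * q 1)] (mod (int p * int n))"
    and norm_progression_later: "2 \<le> c \<Longrightarrow> c < n \<Longrightarrow> [(\<Sum>i<n. (b ^^ (k * i)) q c) = 0] (mod int p)"
proof -
  have "[(\<Sum>i<n. (b ^^ (k * i)) q 1) = int n * (norm_factor k * q 1)] (mod (int p * int n))
    \<and> (2 \<le> c \<longrightarrow> c < n \<longrightarrow> [(\<Sum>i<n. (b ^^ (k * i)) q c) = 0] (mod int p))"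
  proof (cases "p dvd k")
    case False
    then have "coprime p k"
      using prime by (simp add: prime_imp_coprime)
    then have "coprime k n"
      by (simp add: n_def coprime_commute)
    then have "(\<Sum>i<n. (b ^^ (k * i)) q c) = (\<Sum>i<n. (b ^^ i) q c)" for c
      by (rule sum_periodic_coprime[where h = "\<lambda>i. (b ^^ i) q c", rotated]) (simp add: b_iter_add_n q)
    then show ?thesis
      using norm_first[OF q] norm_later[OF q] False by (simp add: norm_factor_def)
  next
    case True
    then obtain k' where k': "k = p * k'" by blast
    obtain d where d: "n = p * d" using p_dvd_n by blast
    have per: "(b ^^ (k * (i + d))) q c = (b ^^ (k * i)) q c" for i c
    proof -
      have "k * (i + d) = k * i + k' * n"
        by (simp add: k' d algebra_simps)
      moreover have "(b ^^ (m + k' * n)) q = (b ^^ m) q" for m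
        by (induction k') (use b_iter_add_n[OF q, of "m + _ * n"] in \<open>auto simp: algebra_simps\<close>)
      ultimately show ?thesis by simp
    qed
    have blocks: "(\<Sum>i<n. (b ^^ (k * i)) q c) = int p * (\<Sum>i<d. (b ^^ (k * i)) q c)" for c
      unfolding d by (rule sum_periodic_blocks[where h = "\<lambda>i. (b ^^ (k * i)) q c", OF per])
    have "[(\<Sum>i<d. (b ^^ (k * i)) q 1) = (\<Sum>i<d. q 1)] (mod int n)"
      by (intro cong_sum b_iter_first_mod_n q)
    then have "[int p * (\<Sum>i<d. (b ^^ (k * i)) q 1) = int p * (\<Sum>i<d. q 1)] (mod (int p * int n))"
      by (rule cong_cmult_leftI)
    moreover have "int p * (\<Sum>i<d. q 1) = int n * (norm_factor k * q 1)"
      using True by (simp add: d norm_factor_def)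
    ultimately have "[int p * (\<Sum>i<d. (b ^^ (k * i)) q 1) = int n * (norm_factor k * q 1)]
        (mod (int p * int n))"
      by metis
    then show ?thesis
      unfolding blocks by (simp add: cong_0_iff)
  qed
  then show "[(\<Sum>i<n. (b ^^ (k * i)) q 1) = int n * (norm_factor k * q 1)] (mod (int p * int n))"
    and "2 \<le> c \<Longrightarrow> c < n \<Longrightarrow> [(\<Sum>i<n. (b ^^ (k * i)) q c) = 0] (mod int p)"
    by blast+
qed

section \<open>Powers in the semidirect product\<close>

lemma b_in_B: "b \<in> carrier B"
  by (rule b_map_in_b_group[OF p_gt_3 j_pos])

lemma B_mult_apply:
  assumes "f \<in> carrier B" "f' \<in> carrier B" "q \<in> carrier P"
  shows "(f \<otimes>\<^bsub>B\<^esub> f') q = f (f' q)"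
  using assms b_group_auto[of p j]
  by (auto simp: b_group_def subgroup_generated_def AutoGroup_def BijGroup_def auto_def compose_def)

lemma B_one_apply: "q \<in> carrier P \<Longrightarrow> \<one>\<^bsub>B\<^esub> q = q"
  by (simp add: b_group_def AutoGroup_def BijGroup_def)

lemma B_eqI:
  assumes "f \<in> carrier B" "f' \<in> carrier B" "\<And>q. q \<in> carrier P \<Longrightarrow> f q = f' q"
  shows "f = f'"
proof -
  have "f \<in> extensional (carrier P)" "f' \<in> extensional (carrier P)"
    using assms(1,2) b_group_auto[of p j] by (auto simp: auto_def Bij_def)
  then show ?thesis using assms(3) by (rule extensionalityI)
qed

lemma B_pow_apply: "q \<in> carrier P \<Longrightarrow> (b [^]\<^bsub>B\<^esub> (i::nat)) q = (b ^^ i) q"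
proof (induction i arbitrary: q)
  case (Suc i)
  then show ?case
    by (simp add: B_mult_apply b_in_B b_map_carrier[OF p_gt_1] funpow_swap1)
qed (simp add: B_one_apply)

lemma B_pow_n: "b [^]\<^bsub>B\<^esub> n = \<one>\<^bsub>B\<^esub>"
  by (rule B_eqI) (auto simp: b_in_B B_pow_apply B_one_apply b_period)

lemma ord_b_dvd: "B.ord b dvd n"
  using B_pow_n B.pow_eq_id[OF b_in_B] by blast

lemma B_generated: "carrier B = generate B {b}"
proof -
  have "subgroup_generated B {b} = B"
    unfolding b_group_def by (rule group.subgroup_generated2[OF group.AutoGroup[OF group_P]])
  then have "carrier (subgroup_generated B {b}) = carrier B" by simp
  then show ?thesis using b_in_B by (simp add: carrier_subgroup_generated)
qed

text \<open>As \<open>b\<close> has finite order, natural exponents suffice.\<close>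

lemma B_powE:
  assumes "f \<in> carrier B"
  obtains k :: nat where "f = b [^]\<^bsub>B\<^esub> k"
proof -
  have "B.ord b \<noteq> 0"
    using ord_b_dvd n_ge_4 by (metis dvd_0_left not_numeral_le_zero)
  then show ?thesis
    using B.generate_pow_nat[OF b_in_B] assms that unfolding B_generated by blast
qed

lemma S_carrier_iff: "(q, f) \<in> carrier S \<longleftrightarrow> q \<in> carrier P \<and> f \<in> carrier B"
  by (simp add: S_group_def semidirect_product_def)

lemma S_mult: "(q, f) \<otimes>\<^bsub>S\<^esub> (q', f') = (q \<otimes>\<^bsub>P\<^esub> f q', f \<otimes>\<^bsub>B\<^esub> f')"
  by (simp add: S_group_def semidirect_product_def)

lemma S_one: "\<one>\<^bsub>S\<^esub> = (\<one>\<^bsub>P\<^esub>, \<one>\<^bsub>B\<^esub>)"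
  by (simp add: S_group_def semidirect_product_def)

lemma P_one_nth: "c \<in> P_index p j \<Longrightarrow> \<one>\<^bsub>P\<^esub> c = 0"
  by (simp add: P_group_def)

lemma S_pow:
  assumes q: "q \<in> carrier P"
  shows S_pow_snd: "snd ((q, b [^]\<^bsub>B\<^esub> k) [^]\<^bsub>S\<^esub> i) = b [^]\<^bsub>B\<^esub> (k * i)"
    and S_pow_fst: "c \<in> P_index p j \<Longrightarrow>
      [fst ((q, b [^]\<^bsub>B\<^esub> k) [^]\<^bsub>S\<^esub> i) c = (\<Sum>s<i. (b ^^ (k * s)) q c)] (mod int (P_ord p j c))"
proof -
  let ?x = "(q, b [^]\<^bsub>B\<^esub> k)"
  have snd: "snd (?x [^]\<^bsub>S\<^esub> i) = b [^]\<^bsub>B\<^esub> (k * i)" for i :: nat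
  proof (induction i)
    case (Suc i)
    obtain v w where vw: "?x [^]\<^bsub>S\<^esub> i = (v, w)" by fastforce
    then show ?case
      using Suc by (simp add: S_mult B.nat_pow_mult b_in_B add.commute)
  qed (simp add: S_one)
  then show "snd (?x [^]\<^bsub>S\<^esub> i) = b [^]\<^bsub>B\<^esub> (k * i)" .
  assume c: "c \<in> P_index p j"
  show "[fst (?x [^]\<^bsub>S\<^esub> i) c = (\<Sum>s<i. (b ^^ (k * s)) q c)] (mod int (P_ord p j c))"
  proof (induction i)
    case (Suc i)
    obtain v w where vw: "?x [^]\<^bsub>S\<^esub> i = (v, w)" by fastforce
    then have "w = b [^]\<^bsub>B\<^esub> (k * i)" using snd[of i] by simp
    then have "fst (?x [^]\<^bsub>S\<^esub> Suc i) = v \<otimes>\<^bsub>P\<^esub> (b ^^ (k * i)) q"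
      using vw by (simp add: S_mult B_pow_apply q)
    then have "[fst (?x [^]\<^bsub>S\<^esub> Suc i) c = v c + (b ^^ (k * i)) q c] (mod int (P_ord p j c))"
      by (simp add: P_mult_nth[OF c] cong_def)
    also have "[v c + (b ^^ (k * i)) q c = (\<Sum>s<i. (b ^^ (k * s)) q c) + (b ^^ (k * i)) q c]
        (mod int (P_ord p j c))"
      using Suc vw by (intro cong_add) auto
    finally show ?case by simp
  qed (simp add: S_one P_one_nth[OF c])
qed

lemma a1_carrier: "a1 \<in> carrier P"
  unfolding a1_def by (rule P_gen_carrier[OF p_gt_1])

lemma a1_nth: "c \<in> P_index p j \<Longrightarrow> a1 c = (if c = 1 then 1 else 0)"
  by (simp add: a1_def P_gen_def)

lemma a1_pow_first: "[(a1 [^]\<^bsub>P\<^esub> (x::int)) 1 = x] (mod (int p * int n))"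
proof -
  have i: "1 \<in> P_index p j" by (simp add: P_index_iff)
  show ?thesis
    using P_int_pow_nth[OF i a1_carrier, of x] i P_ord_first by (simp add: a1_nth cong_def)
qed

lemma a1_pow_later: "2 \<le> c \<Longrightarrow> c < n \<Longrightarrow> [(a1 [^]\<^bsub>P\<^esub> (x::int)) c = 0] (mod int p)"
  using P_int_pow_nth[OF _ a1_carrier, of c x] by (simp add: P_index_iff a1_nth)

lemma a1_pow_eq_iff:
  "a1 [^]\<^bsub>P\<^esub> (int n * x) = a1 [^]\<^bsub>P\<^esub> (int n * y) \<longleftrightarrow> [x = y] (mod int p)"
proof
  assume eq: "a1 [^]\<^bsub>P\<^esub> (int n * x) = a1 [^]\<^bsub>P\<^esub> (int n * y)"
  have "[int n * x = int n * y] (mod (int p * int n))"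
    using a1_pow_first[of "int n * x"] a1_pow_first[of "int n * y"] unfolding eq
    by (meson cong_sym cong_trans)
  then have "int n * int p dvd int n * (x - y)"
    by (simp only: cong_iff_dvd_diff right_diff_distrib mult.commute[of "int p"])
  moreover have "int n \<noteq> 0" using n_ge_4 by simp
  ultimately have "int p dvd x - y" using dvd_times_left_cancel_iff by blast
  then show "[x = y] (mod int p)" by (simp add: cong_iff_dvd_diff)
next
  assume "[x = y] (mod int p)"
  then have "[int n * x = int n * y] (mod (int n * int p))"
    by (rule cong_cmult_leftI)
  then have *: "[int n * x = int n * y] (mod (int p * int n))"
    by (simp add: mult.commute)
  show "a1 [^]\<^bsub>P\<^esub> (int n * x) = a1 [^]\<^bsub>P\<^esub> (int n * y)"
  proof (rule P_eq_congI)
    show "[(a1 [^]\<^bsub>P\<^esub> (int n * x)) 1 = (a1 [^]\<^bsub>P\<^esub> (int n * y)) 1] (mod (int p * int n))"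
      using a1_pow_first[of "int n * x"] a1_pow_first[of "int n * y"] *
      by (meson cong_sym cong_trans)
    show "[(a1 [^]\<^bsub>P\<^esub> (int n * x)) c = (a1 [^]\<^bsub>P\<^esub> (int n * y)) c] (mod int p)" if "2 \<le> c" "c < n" for c
      using a1_pow_later[OF that] by (meson cong_sym cong_trans)
  qed (intro P.int_pow_closed a1_carrier)+
qed

text \<open>All coordinates of the sum over the orbit vanish except the first one, so that the sum is a power
  of \<open>a\<^sub>1\<close>, with the exponent given by \<open>norm_progression_first\<close>.\<close>

lemma S_pow_n:
  assumes q: "q \<in> carrier P"
  shows "(q, b [^]\<^bsub>B\<^esub> k) [^]\<^bsub>S\<^esub> n = (a1 [^]\<^bsub>P\<^esub> (int n * (norm_factor k * q 1)), \<one>\<^bsub>B\<^esub>)"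
proof (rule prod_eqI)
  let ?x = "(q, b [^]\<^bsub>B\<^esub> k) [^]\<^bsub>S\<^esub> n"
  have "b [^]\<^bsub>B\<^esub> (k * n) = \<one>\<^bsub>B\<^esub>"
    using B.nat_pow_pow[OF b_in_B, of n k] by (simp add: B_pow_n mult.commute)
  then show "snd ?x = snd (a1 [^]\<^bsub>P\<^esub> (int n * (norm_factor k * q 1)), \<one>\<^bsub>B\<^esub>)"
    using S_pow_snd[OF q] by simp
  have "?x \<in> carrier S"
    by (intro S.nat_pow_closed) (simp add: S_carrier_iff q b_in_B)
  then have "fst ?x \<in> carrier P"
    by (metis S_carrier_iff prod.collapse)
  then have "fst ?x = a1 [^]\<^bsub>P\<^esub> (int n * (norm_factor k * q 1))"
  proof (rule P_eq_congI)
    have "[fst ?x 1 = (\<Sum>s<n. (b ^^ (k * s)) q 1)] (mod (int p * int n))"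
      using S_pow_fst[OF q, of 1] P_ord_first by (simp add: P_index_iff)
    also have "[(\<Sum>s<n. (b ^^ (k * s)) q 1) = int n * (norm_factor k * q 1)] (mod (int p * int n))"
      by (rule norm_progression_first[OF q])
    also have "[int n * (norm_factor k * q 1) = (a1 [^]\<^bsub>P\<^esub> (int n * (norm_factor k * q 1))) 1] (mod (int p * int n))"
      by (rule cong_sym[OF a1_pow_first])
    finally show "[fst ?x 1 = (a1 [^]\<^bsub>P\<^esub> (int n * (norm_factor k * q 1))) 1] (mod (int p * int n))" .
  next
    fix c assume c: "2 \<le> c" "c < n"
    have "[fst ?x c = (\<Sum>s<n. (b ^^ (k * s)) q c)] (mod int p)"
      using S_pow_fst[OF q, of c] P_ord_other[of c] c by (simp add: P_index_iff)
    also have "[(\<Sum>s<n. (b ^^ (k * s)) q c) = 0] (mod int p)"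
      by (rule norm_progression_later[OF q c])
    also have "[0 = (a1 [^]\<^bsub>P\<^esub> (int n * (norm_factor k * q 1))) c] (mod int p)"
      by (rule cong_sym[OF a1_pow_later[OF c]])
    finally show "[fst ?x c = (a1 [^]\<^bsub>P\<^esub> (int n * (norm_factor k * q 1))) c] (mod int p)" .
  qed (intro P.int_pow_closed a1_carrier)
  then show "fst ?x = fst (a1 [^]\<^bsub>P\<^esub> (int n * (norm_factor k * q 1)), \<one>\<^bsub>B\<^esub>)" by simp
qed

section \<open>The equations for the sets $G_n(ba_1, a_1^{tn})$\<close>

definition u where "u = S_b p j \<otimes>\<^bsub>S\<^esub> S_a p j 1"

lemma S_a_1: "S_a p j 1 = (a1, \<one>\<^bsub>B\<^esub>)"
  by (simp add: S_a_def a1_def)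

lemma S_a_pow: "S_a p j 1 [^]\<^bsub>S\<^esub> (i::nat) = (a1 [^]\<^bsub>P\<^esub> int i, \<one>\<^bsub>B\<^esub>)"
proof (induction i)
  case (Suc i)
  have "a1 [^]\<^bsub>P\<^esub> int (Suc i) = a1 [^]\<^bsub>P\<^esub> int i \<otimes>\<^bsub>P\<^esub> a1"
    by (simp only: int_pow_int P.nat_pow_Suc)
  then show ?case
    by (simp only: S.nat_pow_Suc Suc) (simp add: S_a_1[unfolded One_nat_def] S_mult B_one_apply a1_carrier)
qed (simp add: S_one)

lemma u_eq: "u = (b a1, b)"
  using b_map_carrier[OF p_gt_1 a1_carrier] b_in_B by (simp add: u_def S_a_def S_b_def S_mult a1_def)

lemma u_carrier: "u \<in> carrier S"
  by (simp add: u_eq S_carrier_iff b_in_B b_map_carrier[OF p_gt_1] a1_carrier)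

lemma mult_u: "(r, b [^]\<^bsub>B\<^esub> k) \<otimes>\<^bsub>S\<^esub> u = (r \<otimes>\<^bsub>P\<^esub> (b ^^ Suc k) a1, b [^]\<^bsub>B\<^esub> Suc k)"
  by (simp add: u_eq S_mult B_pow_apply b_map_carrier[OF p_gt_1] a1_carrier funpow_swap1)

text \<open>The automorphism preserves the first coordinate modulo \<open>n\<close>, hence modulo \<open>p\<close>, so multiplication
  by \<open>u\<close> adds the first coordinate 1 of \<open>a\<^sub>1\<close>.\<close>

lemma mult_u_first:
  assumes "r \<in> carrier P"
  shows "[(r \<otimes>\<^bsub>P\<^esub> (b ^^ i) a1) 1 = r 1 + 1] (mod int p)"
proof -
  have i1: "1 \<in> P_index p j" by (simp add: P_index_iff)
  have d: "int p dvd int n" using p_dvd_n by simp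
  have "[(r \<otimes>\<^bsub>P\<^esub> (b ^^ i) a1) 1 = r 1 + (b ^^ i) a1 1] (mod int p)"
    by (rule cong_dvd_modulus[of _ _ "int (P_ord p j 1)"])
      (simp_all only: P_mult_nth[OF i1] P_ord_first dvd_triv_left cong_mod_left cong_refl)
  also have "[r 1 + (b ^^ i) a1 1 = r 1 + a1 1] (mod int p)"
    by (intro cong_add cong_refl cong_dvd_modulus[OF b_iter_first_mod_n[OF a1_carrier] d])
  finally show ?thesis using i1 by (simp add: a1_nth)
qed

text \<open>The candidate \<open>a\<close> is parametrised by \<open>a u\<^sup>-\<^sup>1\<close>, so that no inverse has to be computed. Since
  \<open>a\<^sub>1\<close> to the power \<open>n\<close> has order \<open>p\<close>, only exponents modulo \<open>p\<close> matter.\<close>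

lemma in_G_set_iff:
  assumes r: "r \<in> carrier P"
  shows "(r, b [^]\<^bsub>B\<^esub> k) \<otimes>\<^bsub>S\<^esub> u \<in> G_set S n u (S_a p j 1 [^]\<^bsub>S\<^esub> (t * n))
    \<longleftrightarrow> [norm_factor k * r 1 = int t] (mod int p) \<and>
        [norm_factor (Suc k) * (r 1 + 1) = int t] (mod int p)"
proof -
  let ?x = "(r, b [^]\<^bsub>B\<^esub> k)"
  let ?q = "r \<otimes>\<^bsub>P\<^esub> (b ^^ Suc k) a1"
  have x: "?x \<in> carrier S" by (simp add: S_carrier_iff r b_in_B)
  have q: "?q \<in> carrier P" by (intro P.m_closed r b_iter_carrier a1_carrier)
  have x': "?x \<otimes>\<^bsub>S\<^esub> u \<otimes>\<^bsub>S\<^esub> inv\<^bsub>S\<^esub> u = ?x"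
    using x u_carrier by (simp add: S.m_assoc)
  have g: "S_a p j 1 [^]\<^bsub>S\<^esub> (t * n) = (a1 [^]\<^bsub>P\<^esub> (int n * int t), \<one>\<^bsub>B\<^esub>)"
    by (simp only: S_a_pow of_nat_mult mult.commute)
  have pow: "(y, b [^]\<^bsub>B\<^esub> i) [^]\<^bsub>S\<^esub> n = S_a p j 1 [^]\<^bsub>S\<^esub> (t * n) \<longleftrightarrow>
      [norm_factor i * y 1 = int t] (mod int p)" if "y \<in> carrier P" for y i
    unfolding S_pow_n[OF that] g prod.inject a1_pow_eq_iff by simp
  have "[norm_factor (Suc k) * ?q 1 = norm_factor (Suc k) * (r 1 + 1)] (mod int p)"
    by (rule cong_scalar_left[OF mult_u_first[OF r]])
  then have "[norm_factor (Suc k) * ?q 1 = int t] (mod int p) \<longleftrightarrow>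
      [norm_factor (Suc k) * (r 1 + 1) = int t] (mod int p)"
    by (meson cong_sym cong_trans)
  then have "(?x \<otimes>\<^bsub>S\<^esub> u) [^]\<^bsub>S\<^esub> n = S_a p j 1 [^]\<^bsub>S\<^esub> (t * n) \<longleftrightarrow>
      [norm_factor (Suc k) * (r 1 + 1) = int t] (mod int p)"
    unfolding mult_u pow[OF q] .
  then show ?thesis
    unfolding G_set_def mem_Collect_eq x' pow[OF r] using x u_carrier by auto
qed

text \<open>Eliminating \<open>r 1\<close> from the two congruences shows in each case that \<open>p\<close> divides 1, 2 or 3. The
  divisor 3 is what excludes \<open>p = 3\<close>, for which \<open>1 \<equiv> -2\<close>.\<close>

lemma G_set_first_power_empty: "G_set S n u (S_a p j 1 [^]\<^bsub>S\<^esub> n) = {}"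
proof (rule equals0I)
  fix a assume a: "a \<in> G_set S n u (S_a p j 1 [^]\<^bsub>S\<^esub> n)"
  then have ac: "a \<in> carrier S" by (simp add: G_set_def)
  obtain r f where rf: "a \<otimes>\<^bsub>S\<^esub> inv\<^bsub>S\<^esub> u = (r, f)" by fastforce
  have "(r, f) \<in> carrier S"
    using ac u_carrier by (simp flip: rf)
  then have r: "r \<in> carrier P" and f: "f \<in> carrier B" by (auto simp: S_carrier_iff)
  obtain k :: nat where k: "f = b [^]\<^bsub>B\<^esub> k" using B_powE[OF f] .
  have "a = (r, b [^]\<^bsub>B\<^esub> k) \<otimes>\<^bsub>S\<^esub> u"
    using ac u_carrier by (simp flip: rf k add: S.m_assoc)
  with a have "[norm_factor k * r 1 = int 1] (mod int p)"
    "[norm_factor (Suc k) * (r 1 + 1) = int 1] (mod int p)"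
    using in_G_set_iff[OF r, of k 1] unfolding mult_1 by blast+
  then have d: "int p dvd norm_factor k * r 1 - 1" "int p dvd norm_factor (Suc k) * (r 1 + 1) - 1"
    by (simp_all add: cong_iff_dvd_diff)
  have small: "\<not> int p dvd x" if "x \<in> {1, 2, 3}" for x
    using that p_gt_3 by (auto dest: zdvd_imp_le)
  have "\<not> (p dvd k \<and> p dvd Suc k)"
    using p_gt_1 dvd_diff_nat[of p "Suc k" k] by auto
  then consider "p dvd k" "\<not> p dvd Suc k" | "\<not> p dvd k" "p dvd Suc k" | "\<not> p dvd k" "\<not> p dvd Suc k"
    by blast
  then show False
  proof cases
    case 1
    then have "int p dvd r 1 - 1" "int p dvd 2 * (r 1 + 1) - 1"
      using d by (simp_all only: norm_factor_def if_True if_False mult_1)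
    then have "int p dvd (2 * (r 1 + 1) - 1) - 2 * (r 1 - 1)"
      by (rule dvd_diff[OF _ dvd_mult, rotated])
    then show False using small[of 3] by simp
  next
    case 2
    then have "int p dvd 2 * r 1 - 1" "int p dvd (r 1 + 1) - 1"
      using d by (simp_all only: norm_factor_def if_True if_False mult_1)
    then have "int p dvd 2 * ((r 1 + 1) - 1) - (2 * r 1 - 1)"
      by (rule dvd_diff[OF dvd_mult, rotated])
    then show False using small[of 1] by simp
  next
    case 3
    then have "int p dvd 2 * r 1 - 1" "int p dvd 2 * (r 1 + 1) - 1"
      using d by (simp_all only: norm_factor_def if_False)
    then have "int p dvd (2 * (r 1 + 1) - 1) - (2 * r 1 - 1)"
      by (rule dvd_diff[rotated])
    then show False using small[of 2] by simp
  qed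
qed

text \<open>The element with \<open>a u\<^sup>-\<^sup>1 = a\<^sub>1 b\<^sup>-\<^sup>1\<close> is a solution, namely \<open>a = a\<^sub>1\<^sup>2\<close>. Here
  \<open>b\<^sup>-\<^sup>1\<close> is taken with the natural exponent \<open>n - 1\<close>, which is not divisible by \<open>p\<close>.\<close>

lemma G_set_second_power_nonempty: "G_set S n u (S_a p j 1 [^]\<^bsub>S\<^esub> (2 * n)) \<noteq> {}"
proof -
  have a1: "a1 1 = 1" by (simp add: a1_nth P_index_iff)
  have n: "Suc (n - 1) = n" using n_ge_4 by simp
  have "\<not> p dvd n - 1"
    using p_dvd_n p_gt_1 n_ge_4 dvd_diff_nat[of p n "n - 1"] by auto
  then have "norm_factor (n - 1) = 2" "norm_factor (Suc (n - 1)) = 1"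
    using p_dvd_n unfolding n by (simp_all add: norm_factor_def)
  then show ?thesis
    using in_G_set_iff[OF a1_carrier, of "n - 1" 2] a1 by auto
qed

section \<open>Failure of the $FSZ$ property\<close>

lemma odd_order_S: "odd (order S)"
proof -
  have p: "odd p" using prime p_gt_3 by (simp add: prime_odd_nat)
  have "card (carrier P) = (\<Prod>k\<in>P_index p j. P_ord p j k)"
    unfolding carrier_P[OF p_pos] by (subst card_PiE) (simp_all add: P_index_def)
  moreover have "odd (\<Prod>k\<in>P_index p j. P_ord p j k)"
    using p by (subst even_prod_iff) (auto simp: P_index_def P_ord_def)
  moreover have "odd (card (carrier B))"
    using B.generate_pow_card[OF b_in_B] ord_b_dvd p unfolding B_generated
    by (metis dvd_trans even_power n_def)
  ultimately show ?thesis
    by (simp add: order_def S_group_def semidirect_product_def card_cartesian_product)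
qed

text \<open>The element \<open>a\<^sub>1\<close> to the power \<open>n\<close> is fixed by \<open>b\<close>: its only nontrivial coordinate is divisible
  by \<open>p\<close>, so \<open>b - 1\<close> kills it.\<close>

lemma u_commutes: "u \<otimes>\<^bsub>S\<^esub> (S_a p j 1 [^]\<^bsub>S\<^esub> n) = (S_a p j 1 [^]\<^bsub>S\<^esub> n) \<otimes>\<^bsub>S\<^esub> u"
proof -
  let ?g = "a1 [^]\<^bsub>P\<^esub> int n"
  have g: "?g \<in> carrier P" by (intro P.int_pow_closed a1_carrier)
  have "b ?g = ?g"
  proof (rule P_eq_congI[OF b_map_carrier[OF p_gt_1 g] g])
    have "[int n * ?g (n - 1) = int n * 0] (mod (int n * int p))"
      using a1_pow_later[of "n - 1"] n_ge_4 by (intro cong_cmult_leftI) simp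
    then have "[?g 1 - int n * ?g (n - 1) = ?g 1 - 0] (mod (int p * int n))"
      by (intro cong_diff cong_refl) (simp add: mult.commute)
    with b_first[OF g] show "[b ?g 1 = ?g 1] (mod (int p * int n))"
      by (auto intro: cong_trans)
    have "[?g 1 = int n] (mod int p)"
      by (rule cong_dvd_modulus[OF a1_pow_first]) simp
    then have g1: "[?g 1 = 0] (mod int p)"
      using p_dvd_n by (metis cong_0_iff cong_trans int_dvd_int_iff)
    show "[b ?g c = ?g c] (mod int p)" if c: "2 \<le> c" "c < n" for c
    proof (cases "c = 2")
      case True
      then show ?thesis
        using b_second[OF g] cong_diff[OF cong_refl g1, of "?g 2"] by (auto intro: cong_trans)
    next
      case False
      then have "[b ?g c = ?g c + ?g (c - 1)] (mod int p)" "[?g (c - 1) = 0] (mod int p)"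
        using c b_later[OF g, of c] a1_pow_later[of "c - 1"] by simp_all
      then show ?thesis
        using cong_add[OF cong_refl, of "?g (c - 1)" 0 "int p" "?g c"] by (auto intro: cong_trans)
    qed
  qed
  then show ?thesis
    using b_map_carrier[OF p_gt_1 a1_carrier] g b_in_B
    by (simp only: S_a_pow u_eq S_mult) (simp add: B_one_apply P.m_comm)
qed

lemma not_FSZ: "\<not> FSZ n S"
proof
  assume FSZ: "FSZ n S"
  let ?g = "S_a p j 1 [^]\<^bsub>S\<^esub> n"
  have a: "S_a p j 1 \<in> carrier S" by (rule S_a_carrier[OF p_gt_1])
  have "?g [^]\<^bsub>S\<^esub> (2::int) = ?g [^]\<^bsub>S\<^esub> (2::nat)"
    by (metis int_pow_int of_nat_numeral)
  then have g2: "?g [^]\<^bsub>S\<^esub> (2::int) = S_a p j 1 [^]\<^bsub>S\<^esub> (2 * n)"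
    using S.nat_pow_pow[OF a] by (simp add: mult.commute)
  have "coprime 2 (int (order S))"
    using odd_order_S by simp
  then have "card (G_set S n u ?g) = card (G_set S n u (S_a p j 1 [^]\<^bsub>S\<^esub> (2 * n)))"
    using FSZ u_carrier S.nat_pow_closed[OF a, of n] u_commutes unfolding FSZ_def g2[symmetric] by blast
  then have "card (G_set S n u (S_a p j 1 [^]\<^bsub>S\<^esub> (2 * n))) = 0"
    using G_set_first_power_empty by simp
  moreover have "finite (G_set S n u (S_a p j 1 [^]\<^bsub>S\<^esub> (2 * n)))"
    using finite_S_group[OF p_pos] by (rule rev_finite_subset) (auto simp: G_set_def)
  ultimately show False using G_set_second_power_nonempty by simp
qed

end

theorem theorem1p9:
  fixes p j :: nat
  assumes "prime p" and "p > 3" and "j \<ge> 1"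
  shows "G_set (S_group p j) (p ^ j)
           (S_b p j \<otimes>\<^bsub>S_group p j\<^esub> S_a p j 1)
           (S_a p j 1 [^]\<^bsub>S_group p j\<^esub> (p ^ j)) = {} \<and>
         G_set (S_group p j) (p ^ j)
           (S_b p j \<otimes>\<^bsub>S_group p j\<^esub> S_a p j 1)
           (S_a p j 1 [^]\<^bsub>S_group p j\<^esub> (2 * p ^ j)) \<noteq> {} \<and>
         \<not> FSZ (p ^ j) (S_group p j)"
proof -
  interpret S_parameters p j by unfold_locales fact+
  show ?thesis
    using G_set_first_power_empty G_set_second_power_nonempty not_FSZ by (simp add: n_def u_def)
qed

end
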